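(* Let $\bm{\theta}(t)\in\mathbb{R}^p$, $t\ge 0$, follow the gradient flow $\dot{\bm{\theta}}(t)=-\nabla_{\bm{\theta}}\mathcal{L}(\bm{\theta}(t))$, and assume that at least $C-1$ of the vectors $\{\bm{g}_c(\bm{\theta}(t))-\bm{g}(\bm{\theta}(t))\}_{c=1}^{C}$ are linearly independent. Fix any $t\ge 0$ and write $\bm{H}=\bm{H}(\bm{\theta}(t))$, $\bm{H}_c=\bm{H}_c(\bm{\theta}(t))$, $\bm{P}=\bm{P}(\bm{\theta}(t))$. Assume that, for a scalar $\nu$, $\lambda_{\min}(\bm{H}_c)\ge-\nu$ for all $c\in\{1,\dots,C\}$. Let $\varepsilon\ge\|(\bm{I}-\bm{P})\bm{H}(\bm{I}-\bm{P})\|_2$. Then $\lambda_{\min}(\bm{H})\ge-\nu$, and $$\|(\bm{I}-\bm{P})\bm{H}\|_2\le 2\sqrt{(\varepsilon+\nu)(\|\bm{H}\|_2+\nu)},\qquad \|(\bm{I}-\bm{P})\bm{H}_c\|_2\le\frac{2n}{n_c}\sqrt{(\varepsilon+\nu)(\|\bm{H}\|_2+\nu)},$$ the last bound for every $c\in\{1,\dots,C\}$.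
   Context: Setting. $C$ is the number of classes. Training data $\{(\bm{x}_i,y_i)\}_{i=1}^n$ with $\bm{x}_i\in\mathbb{R}^d$, $y_i\in\{1,\dots,C\}$. A neural network $f(\bm{\theta},\bm{x})\in\mathbb{R}^C$ with parameter $\bm{\theta}\in\mathbb{R}^p$ outputs logits (twice differentiable in $\bm{\theta}$); $\bm{p}(\bm{\theta},\bm{x})=\mathrm{softmax}(f(\bm{\theta},\bm{x}))$. The per-sample loss is the cross-entropy $\ell(f(\bm{\theta},\bm{x}_i),y_i)=-\log \bm{p}(\bm{\theta},\bm{x}_i)_{y_i}$, and $\mathcal{L}(\bm{\theta})=\frac1n\sum_{i=1}^n\ell(f(\bm{\theta},\bm{x}_i),y_i)$. Class quantities. $\mathcal{I}_c=\{i: y_i=c\}$ and $n_c=|\mathcal{I}_c|$ (nonzero) for each $c$. Per-sample gradient $\hat{\bm{g}}_i(\bm{\theta})=\nabla_{\bm{\theta}}\ell(f(\bm{\theta},\bm{x}_i),y_i)$; class gradient $\bm{g}_c(\bm{\theta})=\frac{1}{n_c}\sum_{i\in\mathcal{I}_c}\hat{\bm{g}}_i(\bm{\theta})$; full gradient $\bm{g}(\bm{\theta})=\nabla_{\bm{\theta}}\mathcal{L}(\bm{\theta})=\sum_{c=1}^C\frac{n_c}{n}\bm{g}_c(\bm{\theta})$. Hessian $\bm{H}(\bm{\theta})=\nabla^2_{\bm{\theta}}\mathcal{L}(\bm{\theta})$; class Hessian $\bm{H}_c(\bm{\theta})=\frac{1}{n_c}\sum_{i\in\mathcal{I}_c}\nabla^2_{\bm{\theta}}\ell(f(\bm{\theta},\bm{x}_i),y_i)$,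 so $\bm{H}=\sum_{c=1}^C\frac{n_c}{n}\bm{H}_c$. $\bm{G}(\bm{\theta})\in\mathbb{R}^{(C-1)\times p}$ is the matrix whose $c$-th row is $(\bm{g}_c(\bm{\theta})-\bm{g}(\bm{\theta}))^\top$, $c=1,\dots,C-1$ (of full row rank under the independence assumption, since $\sum_{c}\frac{n_c}{n}(\bm{g}_c-\bm{g})=0$), and $\bm{P}(\bm{\theta})=\bm{G}(\bm{\theta})^\top(\bm{G}(\bm{\theta})\bm{G}(\bm{\theta})^\top)^{-1}\bm{G}(\bm{\theta})\in\mathbb{R}^{p\times p}$ is the orthogonal projection onto the row space of $\bm{G}(\bm{\theta})$. For matrices, $\|\cdot\|_2$ is the operator norm; $\lambda_{\min}$ is the smallest eigenvalue of a symmetric matrix.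
   Formalization: The two norm bounds are stated only for ν ≥ 0, since for negative ν they can fail (e.g. H = H_c = I, ν = −1, ε = 1 with P ≠ I); the bound λ_min(H) ≥ −ν is stated for every scalar ν. *)

theory Defs
  imports "HOL-Analysis.Analysis"
begin

section \<open>Derivatives, eigenvalues and operator norm\<close>

definition gradient :: "(real^'p \<Rightarrow> real) \<Rightarrow> real^'p \<Rightarrow> real^'p" where
  "gradient F \<theta> = (THE D. GDERIV F \<theta> :> D)"

definition hessian :: "(real^'p \<Rightarrow> real) \<Rightarrow> real^'p \<Rightarrow> real^'p^'p" where
  "hessian F \<theta> = jacobian (gradient F) (at \<theta>)"

definition twice_differentiable ::
    "('a::real_normed_vector \<Rightarrow> 'b::real_normed_vector) \<Rightarrow> bool" where
  "twice_differentiable F \<longleftrightarrow>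
     (\<exists>F' :: 'a \<Rightarrow> 'a \<Rightarrow>\<^sub>L 'b.
        (\<forall>\<theta>. (F has_derivative blinfun_apply (F' \<theta>)) (at \<theta>)) \<and>
        (\<forall>\<theta>. F' differentiable (at \<theta>)))"

definition eigenvalues :: "real^'p^'p \<Rightarrow> real set" where
  "eigenvalues A = {l. \<exists>v. v \<noteq> 0 \<and> A *v v = l *\<^sub>R v}"

text \<open>Only meaningful for symmetric \<open>A\<close>, where the set of real eigenvalues is finite and nonempty.\<close>

definition lambda_min :: "real^'p^'p \<Rightarrow> real" where
  "lambda_min A = Min (eigenvalues A)"

abbreviation op_norm :: "real^'m^'k \<Rightarrow> real" where
  "op_norm A \<equiv> onorm (\<lambda>v. A *v v)"

section \<open>Matrices indexed by a finite set\<close>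

text \<open>
  A matrix with one row fewer than there are classes has no index type of its own (and no rows at
  all if there is just one class), so its row index set is an explicit set \<open>S\<close>. The value of
  \<open>inverse_on S M\<close> matters on \<open>S \<times> S\<close> only, where it is the inverse
  of the square matrix \<open>M\<close> restricted to \<open>S \<times> S\<close>, if that is invertible.
\<close>

definition inverse_on :: "'c set \<Rightarrow> ('c \<Rightarrow> 'c \<Rightarrow> real) \<Rightarrow> 'c \<Rightarrow> 'c \<Rightarrow> real" where
  "inverse_on S M = (SOME K. \<forall>a\<in>S. \<forall>b\<in>S.
      (\<Sum>k\<in>S. M a k * K k b) = (if a = b then 1 else 0) \<and>
      (\<Sum>k\<in>S. K a k * M k b) = (if a = b then 1 else 0))"

text \<open>
  \<open>row_projection S v\<close> is \<open>G\<^sup>T (G G\<^sup>T)\<^sup>-\<^sup>1 G\<close> for the matrix \<open>G\<close> whose rows are the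
  vectors \<open>v a\<close>, \<open>a \<in> S\<close>; the entries of \<open>G G\<^sup>T\<close> are the inner products \<open>v a \<bullet> v b\<close>.
\<close>

definition row_projection :: "'c set \<Rightarrow> ('c \<Rightarrow> real^'p) \<Rightarrow> real^'p^'p" where
  "row_projection S v =
     (\<chi> i j. \<Sum>a\<in>S. \<Sum>b\<in>S. v a $ i * inverse_on S (\<lambda>a b. v a \<bullet> v b) a b * v b $ j)"

text \<open>Consistency with the library's matrix operations when \<open>S\<close> is a full type.\<close>

lemma inverse_on_UNIV:
  fixes A :: "real^'c^'c"
  assumes "invertible A"
  shows "(\<chi> a b. inverse_on UNIV (\<lambda>a b. A $ a $ b) a b) = matrix_inv A"
proof -
  let ?Q = "\<lambda>K. \<forall>a\<in>UNIV. \<forall>b\<in>UNIV.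
      (\<Sum>k\<in>UNIV. A $ a $ k * K k b) = (if a = b then 1 else 0) \<and>
      (\<Sum>k\<in>UNIV. K a k * A $ k $ b) = (if a = b then 1 else 0)"
  have Q: "?Q K \<longleftrightarrow> A ** (\<chi> a b. K a b) = mat 1 \<and> (\<chi> a b. K a b) ** A = mat 1" for K
    by (auto simp: matrix_matrix_mult_def mat_def vec_eq_iff)
  have inv: "A ** matrix_inv A = mat 1 \<and> matrix_inv A ** A = mat 1"
    using assms unfolding invertible_def matrix_inv_def by (rule someI_ex)
  have "?Q (\<lambda>a b. matrix_inv A $ a $ b)"
    unfolding Q using inv by simp
  then have "?Q (inverse_on UNIV (\<lambda>a b. A $ a $ b))"
    unfolding inverse_on_def by (rule someI [where P = ?Q])
  then have "A ** (\<chi> a b. inverse_on UNIV (\<lambda>a b. A $ a $ b) a b) = mat 1"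
    unfolding Q by simp
  then show ?thesis
    by (metis inv matrix_mul_assoc matrix_mul_lid matrix_mul_rid)
qed

lemma row_projection_UNIV:
  fixes G :: "real^'p^'c"
  assumes "invertible (G ** transpose G)"
  shows "row_projection UNIV (\<lambda>c. G $ c) =
    transpose G ** matrix_inv (G ** transpose G) ** G"
proof -
  have eq: "(\<lambda>a b. G $ a \<bullet> G $ b) = (\<lambda>a b. (G ** transpose G) $ a $ b)"
    by (simp add: fun_eq_iff matrix_matrix_mult_def transpose_def inner_vec_def)
  show ?thesis
    unfolding row_projection_def eq inverse_on_UNIV [OF assms, symmetric]
    by (subst sum.swap)
      (simp add: vec_eq_iff matrix_matrix_mult_def transpose_def sum_distrib_right)
qed

section \<open>Cross-entropy training\<close>

text \<open>
  Samples are indexed by a finite type \<open>'n\<close>, classes by a finite linear order \<open>'c\<close>; thus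
  \<open>n = CARD('n)\<close>, \<open>C = CARD('c)\<close>, and class \<open>C\<close> is the greatest element of \<open>'c\<close>.
\<close>

definition softmax :: "real^'c \<Rightarrow> real^'c" where
  "softmax z = (\<chi> c. exp (z $ c) / (\<Sum>k\<in>UNIV. exp (z $ k)))"

definition cross_entropy :: "real^'c \<Rightarrow> 'c \<Rightarrow> real" where
  "cross_entropy z c = - ln (softmax z $ c)"

definition sample_loss ::
    "(real^'p \<Rightarrow> real^'d \<Rightarrow> real^'c) \<Rightarrow> ('n \<Rightarrow> real^'d) \<Rightarrow> ('n \<Rightarrow> 'c) \<Rightarrow> 'n \<Rightarrow> real^'p \<Rightarrow> real" where
  "sample_loss f x y i \<theta> = cross_entropy (f \<theta> (x i)) (y i)"

definition train_loss ::
    "(real^'p \<Rightarrow> real^'d \<Rightarrow> real^'c) \<Rightarrow> ('n::finite \<Rightarrow> real^'d) \<Rightarrow> ('n \<Rightarrow> 'c) \<Rightarrow> real^'p \<Rightarrow> real" where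
  "train_loss f x y \<theta> = 1 / real CARD('n) * (\<Sum>i\<in>UNIV. sample_loss f x y i \<theta>)"

definition class_samples :: "('n \<Rightarrow> 'c) \<Rightarrow> 'c \<Rightarrow> 'n set" where
  "class_samples y c = {i. y i = c}"

definition class_gradient ::
    "(real^'p \<Rightarrow> real^'d \<Rightarrow> real^'c) \<Rightarrow> ('n::finite \<Rightarrow> real^'d) \<Rightarrow> ('n \<Rightarrow> 'c) \<Rightarrow> 'c \<Rightarrow> real^'p \<Rightarrow> real^'p" where
  "class_gradient f x y c \<theta> = (1 / real (card (class_samples y c))) *\<^sub>R
     (\<Sum>i\<in>class_samples y c. gradient (sample_loss f x y i) \<theta>)"

definition class_hessian ::
    "(real^'p \<Rightarrow> real^'d \<Rightarrow> real^'c) \<Rightarrow> ('n::finite \<Rightarrow> real^'d) \<Rightarrow> ('n \<Rightarrow> 'c) \<Rightarrow> 'c \<Rightarrow> real^'p \<Rightarrow> real^'p^'p" where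
  "class_hessian f x y c \<theta> = (1 / real (card (class_samples y c))) *\<^sub>R
     (\<Sum>i\<in>class_samples y c. hessian (sample_loss f x y i) \<theta>)"

definition centered_gradient ::
    "(real^'p \<Rightarrow> real^'d \<Rightarrow> real^'c) \<Rightarrow> ('n::finite \<Rightarrow> real^'d) \<Rightarrow> ('n \<Rightarrow> 'c) \<Rightarrow> 'c \<Rightarrow> real^'p \<Rightarrow> real^'p" where
  "centered_gradient f x y c \<theta> = class_gradient f x y c \<theta> - gradient (train_loss f x y) \<theta>"

text \<open>The rows of \<open>G\<close> are the centered gradients of all classes but the last one.\<close>

definition grad_projection ::
    "(real^'p \<Rightarrow> real^'d \<Rightarrow> real^('c::{finite,linorder})) \<Rightarrow> ('n::finite \<Rightarrow> real^'d) \<Rightarrow> ('n \<Rightarrow> 'c)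
      \<Rightarrow> real^'p \<Rightarrow> real^'p^'p" where
  "grad_projection f x y \<theta> =
     row_projection {c. c < Max UNIV} (\<lambda>c. centered_gradient f x y c \<theta>)"

end

theory Submission
  imports Defs
begin

text \<open>
  Put \<open>Q = I - P\<close>, a symmetric contraction, and let \<open>B\<close> be \<open>H\<close> or \<open>H\<^sub>c\<close>. The matrix \<open>A = B + \<nu> I\<close> is
  positive semidefinite, so the Cauchy-Schwarz inequality of its quadratic form, applied to \<open>Q\<^sup>2 A v\<close>
  and \<open>v\<close>, gives \<open>\<parallel>Q A\<parallel> \<le> sqrt (\<parallel>Q A Q\<parallel> \<parallel>A\<parallel>)\<close> without a matrix square root. For \<open>B = H\<close> the
  two factors are at most \<open>\<epsilon> + \<nu>\<close> and \<open>\<parallel>H\<parallel> + \<nu>\<close>; since \<open>H + \<nu> I\<close> is the average of the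
  \<open>H\<^sub>c + \<nu> I\<close> with weights \<open>n\<^sub>c / n\<close>, they grow at most by \<open>n / n\<^sub>c\<close> for \<open>B = H\<^sub>c\<close>. The error
  \<open>\<nu> \<parallel>Q\<parallel> \<le> \<nu>\<close> made in replacing \<open>A\<close> by \<open>B\<close> is itself below the bound, which costs the
  factor 2.
\<close>

section \<open>Symmetry of second derivatives\<close>

text \<open>The second difference is symmetric in \<open>h\<close> and \<open>k\<close>, hence so is what it approximates.\<close>

lemma second_difference_bound:
  fixes F :: "'a::real_inner \<Rightarrow> real"
  assumes F: "\<And>w. GDERIV F w :> D w" and L: "linear L" and r: "r > 0"
    and D: "\<And>z. norm z \<le> r * (norm h + norm k) \<Longrightarrow> norm (D (a + z) - D a - L z) \<le> e * norm z"
    and e: "e \<ge> 0"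
  shows "\<bar>(F (a + r *\<^sub>R h + r *\<^sub>R k) - F (a + r *\<^sub>R h) - F (a + r *\<^sub>R k) + F a) - r\<^sup>2 * (h \<bullet> L k)\<bar>
    \<le> r\<^sup>2 * (2 * e * norm h * (norm h + norm k))"
proof -
  \<comment> \<open>The second difference is \<open>u r - u 0\<close>, the increment along
    \<open>h\<close> of a first difference along \<open>k\<close>. One use of the mean value theorem
    turns it into a difference of two values of \<open>D\<close>.\<close>
  define u where "u s = F (a + r *\<^sub>R k + s *\<^sub>R h) - F (a + s *\<^sub>R h)" for s
  have line: "((\<lambda>s. F (b + s *\<^sub>R h)) has_derivative (\<lambda>q. (q *\<^sub>R h) \<bullet> D (b + s *\<^sub>R h))) (at s)" for b s
  proof -
    have "((\<lambda>s. b + s *\<^sub>R h) has_derivative (\<lambda>q. q *\<^sub>R h)) (at s)"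
      by (auto intro!: derivative_eq_intros)
    from has_derivative_compose [OF this F [unfolded gderiv_def]] show ?thesis by simp
  qed
  have u: "(u has_real_derivative h \<bullet> D (a + r *\<^sub>R k + s *\<^sub>R h) - h \<bullet> D (a + s *\<^sub>R h)) (at s)" for s
    unfolding u_def has_field_derivative_def
    by (rule has_derivative_eq_rhs, rule has_derivative_diff, rule line, rule line)
      (auto simp: algebra_simps)
  obtain s where s: "0 < s" "s < r" and
    mvt: "u r - u 0 = (r - 0) * (h \<bullet> D (a + r *\<^sub>R k + s *\<^sub>R h) - h \<bullet> D (a + s *\<^sub>R h))"
    using MVT2 [OF r, of u "\<lambda>s. h \<bullet> D (a + r *\<^sub>R k + s *\<^sub>R h) - h \<bullet> D (a + s *\<^sub>R h)"] u
    by blast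
  let ?z = "r *\<^sub>R k + s *\<^sub>R h"
  have sh: "s * norm h \<le> r * norm h" "0 \<le> r * norm k"
    using s r by (auto intro: mult_right_mono)
  have nz: "norm ?z \<le> r * (norm h + norm k)"
    using norm_triangle_ineq [of "r *\<^sub>R k" "s *\<^sub>R h"] s r sh by (simp add: algebra_simps)
  have ns: "norm (s *\<^sub>R h) \<le> r * (norm h + norm k)"
    using s sh unfolding distrib_left by (simp add: add_increasing2)
  have Ld: "L ?z - L (s *\<^sub>R h) = r *\<^sub>R L k"
    using L by (simp add: linear_add linear_scale)
  \<comment> \<open>\<open>D\<close> is controlled near \<open>a\<close> only through its expansion
    at \<open>a\<close>, so both intermediate values are compared with \<open>D a\<close>. In the
    difference \<open>D a\<close> cancels, and linearity of \<open>L\<close> leaves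
    \<open>r *\<^sub>R L k\<close>.\<close>
  let ?E = "(D (a + ?z) - D a - L ?z) - (D (a + s *\<^sub>R h) - D a - L (s *\<^sub>R h))"
  have "norm ?E \<le> e * norm ?z + e * norm (s *\<^sub>R h)"
    by (rule order_trans [OF norm_triangle_ineq4 add_mono [OF D [OF nz] D [OF ns]]])
  also have "\<dots> \<le> e * (r * (norm h + norm k)) + e * (r * (norm h + norm k))"
    using nz ns e by (intro add_mono mult_left_mono)
  finally have E: "norm ?E \<le> 2 * e * r * (norm h + norm k)" by (simp add: algebra_simps)
  have "?E = D (a + ?z) - D (a + s *\<^sub>R h) - (L ?z - L (s *\<^sub>R h))" by simp
  also have "h \<bullet> \<dots> = h \<bullet> D (a + ?z) - h \<bullet> D (a + s *\<^sub>R h) - r * (h \<bullet> L k)"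
    unfolding Ld by (simp add: inner_diff_right)
  finally have hE: "h \<bullet> ?E = h \<bullet> D (a + ?z) - h \<bullet> D (a + s *\<^sub>R h) - r * (h \<bullet> L k)" .
  have "F (a + r *\<^sub>R h + r *\<^sub>R k) - F (a + r *\<^sub>R h) - F (a + r *\<^sub>R k) + F a = u r - u 0"
    by (simp add: u_def add.commute add.left_commute)
  then have "F (a + r *\<^sub>R h + r *\<^sub>R k) - F (a + r *\<^sub>R h) - F (a + r *\<^sub>R k) + F a - r\<^sup>2 * (h \<bullet> L k)
      = r * (h \<bullet> ?E)"
    unfolding mvt hE by (simp add: algebra_simps power2_eq_square)
  moreover have "\<bar>r * (h \<bullet> ?E)\<bar> \<le> r * (norm h * (2 * e * r * (norm h + norm k)))"
    using r E Cauchy_Schwarz_ineq2 [of h ?E]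
    by (auto simp: abs_mult intro!: mult_left_mono order_trans [OF Cauchy_Schwarz_ineq2])
  ultimately show ?thesis
    by (simp add: power2_eq_square algebra_simps)
qed

text \<open>Divided by \<open>r\<^sup>2\<close>, one and the same second difference approximates
  both sides, with an error that is small because the gradient is differentiable at
  \<open>a\<close>.\<close>

lemma symmetric_second_derivative:
  fixes F :: "'a::real_inner \<Rightarrow> real"
  assumes F: "\<And>w. GDERIV F w :> D w" and D: "(D has_derivative L) (at a)"
  shows "h \<bullet> L k = k \<bullet> L h"
proof (rule ccontr)
  assume ne: "h \<bullet> L k \<noteq> k \<bullet> L h"
  \<comment> \<open>Divided by \<open>r\<^sup>2\<close>, the two errors add up to
    \<open>e * (N - 1)\<close>, while the assumed gap is \<open>2 * e * N\<close>. The summand 1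
    keeps \<open>N\<close> positive when \<open>h\<close> and \<open>k\<close> vanish.\<close>
  define N where "N = 2 * (norm h + norm k)\<^sup>2 + 1"
  define e where "e = \<bar>h \<bullet> L k - k \<bullet> L h\<bar> / (2 * N)"
  have N: "N > 0" by (simp add: N_def add_nonneg_pos)
  have e: "e > 0" using ne N by (simp add: e_def)
  have L: "linear L" using D by (rule has_derivative_linear)
  obtain d where d: "d > 0" "\<And>z. norm (z - a) < d \<Longrightarrow> norm (D z - D a - L (z - a)) \<le> e * norm (z - a)"
    using D e unfolding has_derivative_at_alt by blast
  define r where "r = d / (2 * (norm h + norm k + 1))"
  have pos: "norm h + norm k + 1 > 0" by (simp add: add_nonneg_pos)
  have r: "r > 0" using d(1) pos by (simp add: r_def)
  have "r * (norm h + norm k) < r * (norm h + norm k + 1)" using r by simp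
  also have "\<dots> = d / 2" using pos by (simp add: r_def field_simps)
  finally have rd: "r * (norm h + norm k) < d" using d(1) by simp
  have D1: "norm (D (a + z) - D a - L z) \<le> e * norm z" if "norm z \<le> r * (norm h + norm k)" for z
    using d(2) [of "a + z"] that rd by simp
  let ?X = "F (a + r *\<^sub>R h + r *\<^sub>R k) - F (a + r *\<^sub>R h) - F (a + r *\<^sub>R k) + F a"
  have 1: "\<bar>?X - r\<^sup>2 * (h \<bullet> L k)\<bar> \<le> r\<^sup>2 * (2 * e * norm h * (norm h + norm k))"
    using second_difference_bound [OF F L r D1] e by simp
  have "\<bar>(F (a + r *\<^sub>R k + r *\<^sub>R h) - F (a + r *\<^sub>R k) - F (a + r *\<^sub>R h) + F a) - r\<^sup>2 * (k \<bullet> L h)\<bar>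
      \<le> r\<^sup>2 * (2 * e * norm k * (norm k + norm h))"
    using second_difference_bound [OF F L r, of k h a e] D1 e by (simp add: add.commute)
  then have 2: "\<bar>?X - r\<^sup>2 * (k \<bullet> L h)\<bar> \<le> r\<^sup>2 * (2 * e * norm k * (norm h + norm k))"
    by (simp add: algebra_simps)
  have "r\<^sup>2 * \<bar>h \<bullet> L k - k \<bullet> L h\<bar> = \<bar>r\<^sup>2 * (h \<bullet> L k) - r\<^sup>2 * (k \<bullet> L h)\<bar>"
    by (simp flip: abs_mult right_diff_distrib add: abs_mult)
  also have "\<dots> \<le> r\<^sup>2 * (2 * e * norm h * (norm h + norm k)) + r\<^sup>2 * (2 * e * norm k * (norm h + norm k))"
    using 1 2 by linarith
  also have "\<dots> = r\<^sup>2 * (e * (2 * (norm h + norm k)\<^sup>2))"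
    by (simp add: power2_eq_square algebra_simps)
  finally have "\<bar>h \<bullet> L k - k \<bullet> L h\<bar> \<le> e * (2 * (norm h + norm k)\<^sup>2)"
    using r by simp
  also have "\<dots> < 2 * (e * N)" using e by (simp add: N_def algebra_simps add_pos_nonneg)
  also have "\<dots> = \<bar>h \<bullet> L k - k \<bullet> L h\<bar>" using N by (simp add: e_def)
  finally show False by simp
qed

section \<open>Symmetric matrices\<close>

lemma inner_symmetric_matrix:
  fixes A :: "real^'p^'p"
  assumes "transpose A = A"
  shows "(A *v u) \<bullet> v = u \<bullet> (A *v v)"
  by (metis assms dot_lmul_matrix transpose_matrix_vector)

text \<open>The form at \<open>c *\<^sub>R u - b *\<^sub>R v\<close> is
  \<open>c * (a * c - b\<^sup>2)\<close>, which settles \<open>c > 0\<close>. Semidefiniteness also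
  allows \<open>c = 0\<close>; then the form along \<open>u + s *\<^sub>R v\<close> is affine in
  \<open>s\<close> and bounded below, so its slope \<open>2 * b\<close> is zero.\<close>

lemma psd_Cauchy_Schwarz:
  fixes A :: "real^'p^'p"
  assumes A: "transpose A = A" and psd: "\<And>w. 0 \<le> w \<bullet> (A *v w)"
  shows "(u \<bullet> (A *v v))\<^sup>2 \<le> (u \<bullet> (A *v u)) * (v \<bullet> (A *v v))"
proof -
  define a b c where "a = u \<bullet> (A *v u)" and "b = u \<bullet> (A *v v)" and "c = v \<bullet> (A *v v)"
  have vu: "v \<bullet> (A *v u) = b"
    using inner_symmetric_matrix [OF A, of v u] by (simp add: b_def inner_commute)
  have "0 \<le> (c *\<^sub>R u - b *\<^sub>R v) \<bullet> (A *v (c *\<^sub>R u - b *\<^sub>R v))" by (rule psd)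
  also have "\<dots> = c * (a * c - b\<^sup>2)"
    using vu by (simp add: a_def b_def c_def matrix_vector_mult_diff_distrib matrix_vector_mult_scaleR
        inner_diff algebra_simps power2_eq_square)
  finally have 1: "0 \<le> c * (a * c - b\<^sup>2)" .
  have 2: "0 \<le> a + 2 * s * b + s\<^sup>2 * c" for s
  proof -
    have "0 \<le> (u + s *\<^sub>R v) \<bullet> (A *v (u + s *\<^sub>R v))" by (rule psd)
    also have "\<dots> = a + 2 * s * b + s\<^sup>2 * c"
      using vu by (simp add: a_def b_def c_def matrix_vector_right_distrib matrix_vector_mult_scaleR
          inner_add algebra_simps power2_eq_square)
    finally show ?thesis .
  qed
  have "c \<ge> 0" using psd by (simp add: c_def)
  moreover have "b = 0" if "c = 0"
  proof (rule ccontr)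
    assume "b \<noteq> 0"
    \<comment> \<open>At this \<open>s\<close> the affine function \<open>a + 2 * s * b\<close>
      takes the value -1.\<close>
    then show False using 2 [of "- (a + 1) / (2 * b)"] that by (simp add: field_simps)
  qed
  ultimately have "b\<^sup>2 \<le> a * c"
    using 1 by (cases "c = 0") (auto simp: zero_le_mult_iff)
  then show ?thesis by (simp add: a_def b_def c_def)
qed

section \<open>The smallest eigenvalue as a lower bound of the quadratic form\<close>

lemma transpose_add_scaled_identity:
  fixes A :: "real^'p^'p"
  assumes "transpose A = A"
  shows "transpose (A + mat m) = A + mat m"
  using assms by (auto simp: transpose_def mat_def vec_eq_iff)

lemma add_scaled_identity_mult:
  fixes A :: "real^'p^'p"
  shows "(A + mat m) *v v = A *v v + m *\<^sub>R v"
  by (simp add: matrix_vector_mult_add_rdistrib)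
    (simp add: mat_def matrix_vector_mult_def vec_eq_iff if_distrib [where f = "\<lambda>x. x * _"] cong: if_cong)

text \<open>The eigenvector is a minimizer \<open>u\<close> of the form on the unit sphere. The form
  of \<open>?B = A + mat (- m)\<close> is nonnegative and vanishes at \<open>u\<close>, so
  Cauchy-Schwarz applied to \<open>?B *v u\<close> and \<open>u\<close> forces
  \<open>?B *v u = 0\<close>, without any differentiation.\<close>

lemma eigenvalue_below_quadratic_form:
  fixes A :: "real^'p^'p"
  assumes A: "transpose A = A"
  shows "\<exists>m\<in>eigenvalues A. \<forall>v. m * (v \<bullet> v) \<le> v \<bullet> (A *v v)"
proof -
  have "\<exists>u\<in>sphere 0 1. \<forall>w\<in>sphere (0::real^'p) 1. u \<bullet> (A *v u) \<le> w \<bullet> (A *v w)"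
    by (intro continuous_attains_inf continuous_on_inner [OF continuous_on_id
          linear_continuous_on [OF matrix_vector_mul_bounded_linear]]) auto
  then obtain u where u: "norm u = 1" and min: "\<And>w. norm w = 1 \<Longrightarrow> u \<bullet> (A *v u) \<le> w \<bullet> (A *v w)"
    by auto
  then have "u \<noteq> 0" by auto
  define m where "m = u \<bullet> (A *v u)"
  have le: "m * (v \<bullet> v) \<le> v \<bullet> (A *v v)" for v
  proof (cases "v = 0")
    case False
    have "m \<le> (v /\<^sub>R norm v) \<bullet> (A *v (v /\<^sub>R norm v))"
      unfolding m_def by (rule min) (use False in simp)
    also have "\<dots> = (v \<bullet> (A *v v)) / (v \<bullet> v)"
      by (simp add: matrix_vector_mult_scaleR dot_square_norm power2_eq_square divide_inverse)
    finally show ?thesis using False by (simp add: field_simps)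
  qed simp
  let ?B = "A + mat (- m)"
  have q: "w \<bullet> (?B *v w) = w \<bullet> (A *v w) - m * (w \<bullet> w)" for w
    by (simp add: add_scaled_identity_mult inner_diff_right)
  have "((?B *v u) \<bullet> (?B *v u))\<^sup>2 \<le> ((?B *v u) \<bullet> (?B *v (?B *v u))) * (u \<bullet> (?B *v u))"
    by (rule psd_Cauchy_Schwarz [OF transpose_add_scaled_identity [OF A]]) (use q le in simp)
  moreover have "u \<bullet> (?B *v u) = 0"
    unfolding q using u by (simp add: m_def dot_square_norm)
  ultimately have "?B *v u = 0" by simp
  then have "A *v u = m *\<^sub>R u" by (simp add: add_scaled_identity_mult)
  then have "m \<in> eigenvalues A"
    using \<open>u \<noteq> 0\<close> unfolding eigenvalues_def by blast
  then show ?thesis using le by blast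
qed

text \<open>Makes the \<open>Min\<close> in \<open>lambda_min\<close> meaningful. Eigenvectors of
  distinct eigenvalues are orthogonal, hence independent, hence finitely many.\<close>

lemma finite_eigenvalues:
  fixes A :: "real^'p^'p"
  assumes A: "transpose A = A"
  shows "finite (eigenvalues A)"
proof -
  have "\<forall>l\<in>eigenvalues A. \<exists>v. v \<noteq> 0 \<and> A *v v = l *\<^sub>R v"
    by (simp add: eigenvalues_def)
  from bchoice [OF this] obtain w
    where w: "\<And>l. l \<in> eigenvalues A \<Longrightarrow> w l \<noteq> 0 \<and> A *v w l = l *\<^sub>R w l"
    by blast
  have orth: "w l \<bullet> w m = 0" if "l \<in> eigenvalues A" "m \<in> eigenvalues A" "l \<noteq> m" for l m
    using inner_symmetric_matrix [OF A, of "w l" "w m"] w that by auto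
  then have "inj_on w (eigenvalues A)"
    using w by (metis inj_onI inner_eq_zero_iff)
  moreover have "pairwise orthogonal (w ` eigenvalues A)"
    using orth by (auto simp: pairwise_def orthogonal_def)
  then have "finite (w ` eigenvalues A)"
    using w by (intro independent_imp_finite pairwise_orthogonal_independent) auto
  ultimately show ?thesis
    by (simp add: finite_image_iff)
qed

lemma lambda_min_eigenvalue:
  fixes A :: "real^'p^'p"
  assumes A: "transpose A = A"
  shows "lambda_min A \<in> eigenvalues A"
proof -
  have "eigenvalues A \<noteq> {}"
    using eigenvalue_below_quadratic_form [OF A] by blast
  with finite_eigenvalues [OF A] show ?thesis
    unfolding lambda_min_def by (rule Min_in)
qed

lemma lambda_min_le_quadratic_form:
  fixes A :: "real^'p^'p"
  assumes A: "transpose A = A"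
  shows "lambda_min A * (v \<bullet> v) \<le> v \<bullet> (A *v v)"
proof -
  obtain m where m: "m \<in> eigenvalues A" "\<And>v. m * (v \<bullet> v) \<le> v \<bullet> (A *v v)"
    using eigenvalue_below_quadratic_form [OF A] by blast
  have "lambda_min A \<le> m"
    unfolding lambda_min_def by (rule Min_le [OF finite_eigenvalues [OF A] m(1)])
  then have "lambda_min A * (v \<bullet> v) \<le> m * (v \<bullet> v)"
    by (intro mult_right_mono) auto
  also have "\<dots> \<le> v \<bullet> (A *v v)" by (rule m)
  finally show ?thesis .
qed

lemma le_lambda_min:
  fixes A :: "real^'p^'p"
  assumes A: "transpose A = A" and le: "\<And>v. m * (v \<bullet> v) \<le> v \<bullet> (A *v v)"
  shows "m \<le> lambda_min A"
proof -
  obtain v where "v \<noteq> 0" "A *v v = lambda_min A *\<^sub>R v"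
    using lambda_min_eigenvalue [OF A] unfolding eigenvalues_def by blast
  then show ?thesis using le [of v] by simp
qed

section \<open>Matrix sums, operator norms and compressions of semidefinite matrices\<close>

lemma sum_matrix_vector_mult:
  fixes M :: "'i \<Rightarrow> real^'p^'k"
  shows "sum M I *v v = (\<Sum>i\<in>I. M i *v v)"
  by (induction I rule: infinite_finite_induct) (auto simp: matrix_vector_mult_add_rdistrib)

lemma transpose_scaleR_sum:
  fixes M :: "'i \<Rightarrow> real^'p^'p"
  assumes "\<And>i. transpose (M i) = M i"
  shows "transpose (c *\<^sub>R sum M I) = c *\<^sub>R sum M I"
proof -
  have "M i $ a $ b = M i $ b $ a" for i a b
    by (subst assms [symmetric]) (simp add: transpose_def)
  then show ?thesis
    by (auto simp: vec_eq_iff transpose_def intro!: sum.cong)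
qed

lemma norm_matrix_vector_le:
  fixes A :: "real^'p^'k"
  shows "norm (A *v v) \<le> op_norm A * norm v"
  by (rule onorm [OF matrix_vector_mul_bounded_linear])

lemma quadratic_form_le_op_norm:
  fixes A :: "real^'p^'p"
  shows "v \<bullet> (A *v v) \<le> op_norm A * (v \<bullet> v)"
proof -
  have "v \<bullet> (A *v v) \<le> norm v * norm (A *v v)" by (rule norm_cauchy_schwarz)
  also have "\<dots> \<le> norm v * (op_norm A * norm v)"
    by (intro mult_left_mono norm_matrix_vector_le) simp
  finally show ?thesis by (simp add: dot_square_norm power2_eq_square algebra_simps)
qed

text \<open>For \<open>?w = Q *v (A *v v)\<close>, symmetry of \<open>Q\<close> turns
  \<open>?w \<bullet> ?w\<close> into \<open>(Q *v ?w) \<bullet> (A *v v)\<close>. Cauchy-Schwarz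
  for \<open>A\<close> bounds its square, and one factor \<open>(norm ?w)\<^sup>2\<close> cancels.
  The constants bound quadratic forms rather than norms, so they pass on to any smaller
  form.\<close>

lemma psd_compression_bound:
  fixes A Q :: "real^'p^'p"
  assumes A: "transpose A = A" and psd: "\<And>w. 0 \<le> w \<bullet> (A *v w)"
    and Q: "transpose Q = Q"
    and \<alpha>: "\<And>w. (Q *v w) \<bullet> (A *v (Q *v w)) \<le> \<alpha> * (w \<bullet> w)"
    and \<beta>: "\<And>w. w \<bullet> (A *v w) \<le> \<beta> * (w \<bullet> w)" and "\<alpha> \<ge> 0"
  shows "norm (Q *v (A *v v)) \<le> sqrt (\<alpha> * \<beta>) * norm v"
proof -
  let ?w = "Q *v (A *v v)"
  have "(?w \<bullet> ?w)\<^sup>2 = ((Q *v ?w) \<bullet> (A *v v))\<^sup>2"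
    by (simp only: inner_symmetric_matrix [OF Q, of ?w "A *v v"])
  also have "\<dots> \<le> ((Q *v ?w) \<bullet> (A *v (Q *v ?w))) * (v \<bullet> (A *v v))"
    by (rule psd_Cauchy_Schwarz [OF A psd])
  also have "\<dots> \<le> (\<alpha> * (?w \<bullet> ?w)) * (\<beta> * (v \<bullet> v))"
    by (rule mult_mono [OF \<alpha> \<beta> _ psd]) (use \<open>\<alpha> \<ge> 0\<close> in simp)
  finally have "(norm ?w)\<^sup>2 * (norm ?w)\<^sup>2 \<le> (norm ?w)\<^sup>2 * (\<alpha> * \<beta> * (norm v)\<^sup>2)"
    by (simp add: dot_square_norm power2_eq_square algebra_simps)
  then have "(norm ?w)\<^sup>2 \<le> \<alpha> * \<beta> * (norm v)\<^sup>2" if "?w \<noteq> 0"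
    by (rule mult_left_le_imp_le) (use that in simp)
  \<comment> \<open>If \<open>?w = 0\<close>, nothing can be cancelled and the right side must be
    nonnegative by itself; \<open>\<beta> * (v \<bullet> v)\<close> is, as it bounds the form at
    \<open>v\<close>.\<close>
  moreover have "0 \<le> \<alpha> * \<beta> * (norm v)\<^sup>2"
    using order_trans [OF psd \<beta>, of v] \<open>\<alpha> \<ge> 0\<close>
    by (simp add: dot_square_norm mult.assoc)
  ultimately have "(norm ?w)\<^sup>2 \<le> \<alpha> * \<beta> * (norm v)\<^sup>2"
    by (cases "?w = 0") auto
  then have "sqrt ((norm ?w)\<^sup>2) \<le> sqrt (\<alpha> * \<beta> * (norm v)\<^sup>2)" by (rule real_sqrt_le_mono)
  then show ?thesis by (simp add: real_sqrt_mult)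
qed

text \<open>Serves both bounds: \<open>\<kappa>\<close> is 1 for the full Hessian and n / n_c for a
  class Hessian. Both factors under the root acquire \<open>\<kappa>\<close>, so it leaves the root
  to the first power.\<close>

lemma op_norm_compression_le:
  fixes B H Q :: "real^'p^'p"
  assumes B: "transpose B = B" and Q: "transpose Q = Q" and Q1: "\<And>w. norm (Q *v w) \<le> norm w"
    and lower: "\<And>w. 0 \<le> w \<bullet> (B *v w) + \<nu> * (w \<bullet> w)"
    and upper: "\<And>w. w \<bullet> (B *v w) + \<nu> * (w \<bullet> w) \<le> \<kappa> * (w \<bullet> (H *v w) + \<nu> * (w \<bullet> w))"
    and \<kappa>: "\<kappa> \<ge> 1" and \<nu>: "\<nu> \<ge> 0" and eps: "\<epsilon> \<ge> op_norm (Q ** H ** Q)"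
  shows "op_norm (Q ** B) \<le> 2 * \<kappa> * sqrt ((\<epsilon> + \<nu>) * (op_norm H + \<nu>))"
proof -
  let ?A = "B + mat \<nu>" and ?h = "op_norm H"
  let ?s = "sqrt ((\<epsilon> + \<nu>) * (?h + \<nu>))"
  have h0: "?h \<ge> 0" and e0: "\<epsilon> \<ge> 0"
    using eps onorm_pos_le [OF matrix_vector_mul_bounded_linear] by (auto intro: order_trans)
  have qA: "w \<bullet> (?A *v w) = w \<bullet> (B *v w) + \<nu> * (w \<bullet> w)" for w
    by (simp add: add_scaled_identity_mult inner_add_right)
  have \<alpha>: "(Q *v w) \<bullet> (?A *v (Q *v w)) \<le> (\<kappa> * (\<epsilon> + \<nu>)) * (w \<bullet> w)" for w
  proof -
    have "(Q *v w) \<bullet> (H *v (Q *v w)) = w \<bullet> ((Q ** H ** Q) *v w)"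
      by (simp add: inner_symmetric_matrix [OF Q] flip: matrix_vector_mul_assoc)
    also have "\<dots> \<le> op_norm (Q ** H ** Q) * (w \<bullet> w)" by (rule quadratic_form_le_op_norm)
    also have "\<dots> \<le> \<epsilon> * (w \<bullet> w)" by (intro mult_right_mono eps) simp
    finally have 1: "(Q *v w) \<bullet> (H *v (Q *v w)) \<le> \<epsilon> * (w \<bullet> w)" .
    have "(Q *v w) \<bullet> (Q *v w) \<le> w \<bullet> w" using Q1 by (simp add: norm_le)
    then have "\<nu> * ((Q *v w) \<bullet> (Q *v w)) \<le> \<nu> * (w \<bullet> w)" using \<nu> by (rule mult_left_mono)
    with 1 have "\<kappa> * ((Q *v w) \<bullet> (H *v (Q *v w)) + \<nu> * ((Q *v w) \<bullet> (Q *v w)))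
        \<le> \<kappa> * (\<epsilon> * (w \<bullet> w) + \<nu> * (w \<bullet> w))"
      using \<kappa> by (intro mult_left_mono) auto
    with upper [of "Q *v w"] show ?thesis unfolding qA by (simp add: algebra_simps)
  qed
  have \<beta>: "w \<bullet> (?A *v w) \<le> (\<kappa> * (?h + \<nu>)) * (w \<bullet> w)" for w
  proof -
    have "\<kappa> * (w \<bullet> (H *v w) + \<nu> * (w \<bullet> w)) \<le> \<kappa> * (?h * (w \<bullet> w) + \<nu> * (w \<bullet> w))"
      using \<kappa> quadratic_form_le_op_norm [of w H] by (intro mult_left_mono) auto
    with upper [of w] show ?thesis unfolding qA by (simp add: algebra_simps)
  qed
  \<comment> \<open>Both factors under the root are at least \<open>\<nu>\<close>, so the root
    dominates the error of removing the shift.\<close>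
  have \<nu>s: "\<nu> \<le> ?s"
  proof -
    have "\<nu> * \<nu> \<le> (\<epsilon> + \<nu>) * (?h + \<nu>)"
      using \<nu> e0 h0 by (intro mult_mono) auto
    then show ?thesis by (intro real_le_rsqrt) (simp add: power2_eq_square)
  qed
  have s: "sqrt ((\<kappa> * (\<epsilon> + \<nu>)) * (\<kappa> * (?h + \<nu>))) = \<kappa> * ?s"
  proof -
    have "(\<kappa> * (\<epsilon> + \<nu>)) * (\<kappa> * (?h + \<nu>)) = \<kappa>\<^sup>2 * ((\<epsilon> + \<nu>) * (?h + \<nu>))"
      by (simp add: power2_eq_square)
    then show ?thesis using \<kappa> by (simp only: real_sqrt_mult real_sqrt_abs)
  qed
  show ?thesis
  proof (rule onorm_le)
    fix v
    have "(Q ** B) *v v = Q *v (?A *v v) - \<nu> *\<^sub>R (Q *v v)"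
      by (simp add: add_scaled_identity_mult matrix_vector_right_distrib matrix_vector_mult_scaleR
          flip: matrix_vector_mul_assoc)
    then have "norm ((Q ** B) *v v) \<le> norm (Q *v (?A *v v)) + norm (\<nu> *\<^sub>R (Q *v v))"
      using norm_triangle_ineq4 by metis
    also have "\<dots> \<le> \<kappa> * ?s * norm v + \<nu> * norm v"
    proof (rule add_mono)
      show "norm (Q *v (?A *v v)) \<le> \<kappa> * ?s * norm v"
        unfolding s [symmetric]
        by (rule psd_compression_bound [OF transpose_add_scaled_identity [OF B] _ Q \<alpha> \<beta>])
          (use lower \<kappa> e0 \<nu> in \<open>auto simp: qA\<close>)
      show "norm (\<nu> *\<^sub>R (Q *v v)) \<le> \<nu> * norm v"
        using \<nu> Q1 by (simp add: mult_left_mono)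
    qed
    also have "\<dots> \<le> \<kappa> * ?s * norm v + \<kappa> * ?s * norm v"
    proof -
      have "\<nu> \<le> \<kappa> * ?s" using \<nu>s \<kappa> \<nu> mult_mono [of 1 \<kappa> \<nu> ?s] by simp
      then show ?thesis by (intro add_left_mono mult_right_mono) auto
    qed
    finally show "norm ((Q ** B) *v v) \<le> 2 * \<kappa> * ?s * norm v" by (simp add: mult_ac)
  qed
qed

section \<open>The projection onto the row space\<close>

text \<open>The functional that is 1 at \<open>v a\<close> and 0 at the other vectors is represented
  by a vector \<open>z\<close>, whose projection \<open>p\<close> onto the span keeps all inner
  products with the \<open>v b\<close>. Lying in the span is what later allows \<open>w a\<close> to
  be expanded in the \<open>v k\<close>.\<close>

lemma dual_basis_exists:
  fixes v :: "'c \<Rightarrow> 'a::euclidean_space"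
  assumes inj: "inj_on v S" and ind: "independent (v ` S)"
  obtains w where "\<And>a. a \<in> S \<Longrightarrow> w a \<in> span (v ` S)"
    "\<And>a b. a \<in> S \<Longrightarrow> b \<in> S \<Longrightarrow> w a \<bullet> v b = (if a = b then 1 else 0)"
proof -
  have "\<exists>w. w \<in> span (v ` S) \<and> (\<forall>b\<in>S. w \<bullet> v b = (if a = b then 1 else 0))" if a: "a \<in> S" for a
  proof -
    obtain g :: "'a \<Rightarrow> real" where g: "linear g"
      and gB: "\<And>x. x \<in> v ` S \<Longrightarrow> g x = (if x = v a then 1 else 0)"
      using linear_independent_extend [OF ind, of "\<lambda>x. if x = v a then 1 else 0"] by auto
    define z where "z = adjoint g 1"
    have z: "z \<bullet> x = g x" for x
      using adjoint_works [OF g, of x 1] by (simp add: z_def inner_commute)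
    obtain p q where p: "p \<in> span (v ` S)" and q: "\<And>x. x \<in> span (v ` S) \<Longrightarrow> orthogonal q x"
      and zpq: "z = p + q"
      using orthogonal_subspace_decomp_exists [of "v ` S" z] by metis
    have "p \<bullet> v b = (if a = b then 1 else 0)" if b: "b \<in> S" for b
    proof -
      have "p \<bullet> v b = z \<bullet> v b"
        using q [of "v b"] b by (simp add: zpq inner_add_left orthogonal_def span_base)
      also have "\<dots> = (if a = b then 1 else 0)"
        using gB [of "v b"] a b inj by (auto simp: z inj_on_eq_iff)
      finally show ?thesis .
    qed
    with p show ?thesis by blast
  qed
  then show thesis using that by metis
qed

text \<open>The inverse of a Gram matrix is the Gram matrix of the dual basis.\<close>

lemma inverse_on_Gram:
  fixes v :: "'c \<Rightarrow> 'a::euclidean_space"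
  assumes fin: "finite S" and inj: "inj_on v S" and ind: "independent (v ` S)"
    and S: "a \<in> S" "b \<in> S"
  shows "(\<Sum>k\<in>S. inverse_on S (\<lambda>a b. v a \<bullet> v b) a k * (v k \<bullet> v b)) = (if a = b then 1 else 0)"
proof -
  obtain w where w: "\<And>a. a \<in> S \<Longrightarrow> w a \<in> span (v ` S)"
    and wv: "\<And>a b. a \<in> S \<Longrightarrow> b \<in> S \<Longrightarrow> w a \<bullet> v b = (if a = b then 1 else 0)"
    using dual_basis_exists [OF inj ind] by metis
  \<comment> \<open>By duality, pairing the expansion of \<open>w a\<close> with \<open>w k\<close>
    isolates the coefficient of \<open>v k\<close>.\<close>
  have exp: "w a = (\<Sum>k\<in>S. (w a \<bullet> w k) *\<^sub>R v k)" if a: "a \<in> S" for a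
  proof -
    obtain u where u: "w a = (\<Sum>x\<in>v ` S. u x *\<^sub>R x)"
      using w [OF a] span_finite [of "v ` S"] fin by auto
    then have u': "w a = (\<Sum>k\<in>S. u (v k) *\<^sub>R v k)"
      by (simp add: sum.reindex [OF inj])
    have "w a \<bullet> w k = u (v k)" if k: "k \<in> S" for k
    proof -
      have "w a \<bullet> w k = (\<Sum>l\<in>S. u (v l) * (w k \<bullet> v l))"
        by (subst inner_commute) (simp add: u' inner_sum_right)
      also have "\<dots> = (\<Sum>l\<in>S. if k = l then u (v l) else 0)"
        using k by (intro sum.cong) (auto simp: wv)
      finally show ?thesis using k fin by simp
    qed
    then show ?thesis by (simp add: u' cong: sum.cong)
  qed
  have L: "(\<Sum>k\<in>S. (w a \<bullet> w k) * (v k \<bullet> v b)) = (if a = b then 1 else 0)"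
    if "a \<in> S" "b \<in> S" for a b
  proof -
    have "(\<Sum>k\<in>S. (w a \<bullet> w k) * (v k \<bullet> v b)) = (\<Sum>k\<in>S. (w a \<bullet> w k) *\<^sub>R v k) \<bullet> v b"
      by (simp add: inner_sum_left)
    also have "\<dots> = w a \<bullet> v b" using exp [OF that(1)] by simp
    finally show ?thesis using wv that by simp
  qed
  let ?M = "\<lambda>a b. v a \<bullet> v b"
  let ?spec = "\<lambda>K. \<forall>a\<in>S. \<forall>b\<in>S.
      (\<Sum>k\<in>S. ?M a k * K k b) = (if a = b then 1 else 0) \<and>
      (\<Sum>k\<in>S. K a k * ?M k b) = (if a = b then 1 else 0)"
  have R: "(\<Sum>k\<in>S. (v a \<bullet> v k) * (w k \<bullet> w b)) = (if a = b then 1 else 0)"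
    if "a \<in> S" "b \<in> S" for a b
    using L [OF that(2,1)] by (simp add: inner_commute mult.commute eq_commute)
  \<comment> \<open>\<open>inverse_on\<close> is a choice, so exhibiting one two-sided inverse shows
    that the chosen matrix is one as well.\<close>
  have "?spec (\<lambda>a b. w a \<bullet> w b)" using L R by blast
  then have "?spec (inverse_on S ?M)"
    unfolding inverse_on_def by (rule someI [where P = ?spec])
  then show ?thesis using S by blast
qed

lemma row_projection_mult:
  fixes v :: "'c \<Rightarrow> real^'p"
  shows "row_projection S v *v x =
    (\<Sum>a\<in>S. (\<Sum>b\<in>S. inverse_on S (\<lambda>a b. v a \<bullet> v b) a b * (v b \<bullet> x)) *\<^sub>R v a)"
proof -
  let ?J = "inverse_on S (\<lambda>a b. v a \<bullet> v b)"
  have "(row_projection S v *v x) $ i = (\<Sum>a\<in>S. (\<Sum>b\<in>S. ?J a b * (v b \<bullet> x)) * v a $ i)" for i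
  proof -
    have "(row_projection S v *v x) $ i
        = (\<Sum>j\<in>UNIV. \<Sum>a\<in>S. \<Sum>b\<in>S. v a $ i * ?J a b * v b $ j * x $ j)"
      by (simp add: row_projection_def matrix_vector_mult_def sum_distrib_right)
    also have "\<dots> = (\<Sum>a\<in>S. \<Sum>b\<in>S. \<Sum>j\<in>UNIV. v a $ i * ?J a b * v b $ j * x $ j)"
      by (subst sum.swap) (intro sum.cong refl sum.swap)
    also have "\<dots> = (\<Sum>a\<in>S. (\<Sum>b\<in>S. ?J a b * (v b \<bullet> x)) * v a $ i)"
      by (simp add: inner_vec_def sum_distrib_left sum_distrib_right algebra_simps)
    finally show ?thesis .
  qed
  then show ?thesis by (simp add: vec_eq_iff)
qed

text \<open>Applied to a row, the inverse Gram matrix meets the Gram matrix, so rows are fixed, and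
  with them their span. Vectors orthogonal to all rows go to 0. Splitting \<open>x\<close> into
  these two parts shows that \<open>x\<close> minus its image is the orthogonal part.\<close>

lemma row_projection_orthogonal_decomposition:
  fixes v :: "'c \<Rightarrow> real^'p"
  assumes fin: "finite S" and inj: "inj_on v S" and ind: "independent (v ` S)"
  shows "row_projection S v *v x \<in> span (v ` S)"
    and "y \<in> span (v ` S) \<Longrightarrow> (x - row_projection S v *v x) \<bullet> y = 0"
proof -
  let ?P = "row_projection S v" and ?J = "inverse_on S (\<lambda>a b. v a \<bullet> v b)"
  show range: "?P *v x \<in> span (v ` S)" for x
    unfolding row_projection_mult by (intro span_sum span_scale span_base) auto
  have gen: "?P *v v c = v c" if "c \<in> S" for c
  proof -
    have "?P *v v c = (\<Sum>a\<in>S. (if a = c then 1 else 0) *\<^sub>R v a)"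
      unfolding row_projection_mult
      by (intro sum.cong refl) (use inverse_on_Gram [OF fin inj ind] that in simp)
    also have "\<dots> = (\<Sum>a\<in>S. if a = c then v a else 0)" by (intro sum.cong) auto
    finally show ?thesis using fin that by simp
  qed
  have fix_span: "?P *v y = y" if "y \<in> span (v ` S)" for y
    by (rule linear_eq_on [OF _ _ that, of "\<lambda>y. ?P *v y" "\<lambda>y. y"])
      (auto simp: gen linear_id [unfolded id_def])
  assume y: "y \<in> span (v ` S)"
  obtain p q where p: "p \<in> span (v ` S)" and q: "\<And>x. x \<in> span (v ` S) \<Longrightarrow> orthogonal q x"
    and xpq: "x = p + q"
    using orthogonal_subspace_decomp_exists [of "v ` S" x] by metis
  have "v b \<bullet> q = 0" if "b \<in> S" for b
    using q [of "v b"] that by (simp add: span_base orthogonal_def inner_commute)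
  then have "?P *v q = 0" by (simp add: row_projection_mult)
  then have "x - ?P *v x = q"
    using fix_span [OF p] by (simp add: xpq matrix_vector_right_distrib)
  then show "(x - ?P *v x) \<bullet> y = 0" using q [OF y] by (simp add: orthogonal_def)
qed

text \<open>Both properties follow from
  \<open>(Q *v z) \<bullet> z' = (Q *v z) \<bullet> (Q *v z')\<close>: the right side is symmetric
  in \<open>z\<close> and \<open>z'\<close>, and \<open>z = z' = x\<close> with Cauchy-Schwarz gives
  the contraction.\<close>

lemma row_projection_complement:
  fixes v :: "'c \<Rightarrow> real^'p"
  assumes fin: "finite S" and inj: "inj_on v S" and ind: "independent (v ` S)"
  defines "Q \<equiv> mat 1 - row_projection S v"
  shows "transpose Q = Q" and "norm (Q *v x) \<le> norm x"
proof -
  note [simp] = row_projection_orthogonal_decomposition [OF fin inj ind]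
  let ?P = "row_projection S v"
  have Q: "Q *v z = z - ?P *v z" for z
    by (simp add: Q_def matrix_vector_mult_diff_rdistrib)
  have QP: "(Q *v z) \<bullet> (?P *v z') = 0" for z z'
    unfolding Q by simp
  have QQ: "(Q *v z) \<bullet> z' = (Q *v z) \<bullet> (Q *v z')" for z z'
    using QP [of z z'] by (simp add: Q [of z'] inner_diff_right)
  have "(Q *v z) \<bullet> z' = z \<bullet> (Q *v z')" for z z'
    using QQ [of z z'] QQ [of z' z] by (simp add: inner_commute)
  then have "adjoint (\<lambda>z. Q *v z) = (\<lambda>z. Q *v z)"
    by (intro adjoint_unique) (simp add: inner_commute)
  then have "(\<lambda>z. transpose Q *v z) = (\<lambda>z. Q *v z)"
    by (simp add: adjoint_matrix)
  then show "transpose Q = Q" by (metis matrix_of_matrix_vector_mul)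
  have "(norm (Q *v x))\<^sup>2 = (Q *v x) \<bullet> x"
    by (simp add: QQ [of x x] dot_square_norm)
  also have "\<dots> \<le> norm (Q *v x) * norm x" by (rule norm_cauchy_schwarz)
  finally show "norm (Q *v x) \<le> norm x"
    by (cases "Q *v x = 0") (auto simp: power2_eq_square)
qed

text \<open>Converts independence over some unknown \<open>S\<close> into independence of all
  vectors but a prescribed one. The relation puts \<open>u m\<close> into the span of the others,
  which therefore has dimension at least \<open>CARD('c) - 1\<close>. With only that many indices
  left, their vectors must be distinct and independent.\<close>

lemma independent_remove_one:
  fixes u :: "'c::finite \<Rightarrow> 'a::euclidean_space"
  assumes rel: "(\<Sum>c\<in>UNIV. r c *\<^sub>R u c) = 0" and r: "r m \<noteq> 0"
    and card: "card S \<ge> CARD('c) - 1" and inj: "inj_on u S" and ind: "independent (u ` S)"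
  shows "inj_on u (UNIV - {m})" and "independent (u ` (UNIV - {m}))"
proof -
  let ?T = "UNIV - {m}"
  have T: "card ?T = CARD('c) - 1" by (simp add: card_Diff_singleton)
  have "r m *\<^sub>R u m = - (\<Sum>c\<in>?T. r c *\<^sub>R u c)"
    using rel by (simp add: sum.remove [of UNIV m] eq_neg_iff_add_eq_0)
  also have "\<dots> \<in> span (u ` ?T)"
    by (intro span_neg span_sum span_scale span_base) auto
  finally have "(1 / r m) *\<^sub>R (r m *\<^sub>R u m) \<in> span (u ` ?T)" by (rule span_scale)
  then have m: "u m \<in> span (u ` ?T)" using r by simp
  have "u c \<in> span (u ` ?T)" for c
    using m by (cases "c = m") (auto intro: span_base)
  then have "u ` S \<subseteq> span (u ` ?T)" by auto
  then have "card (u ` S) \<le> dim (span (u ` ?T))"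
    by (metis ind dim_eq_card_independent dim_subset)
  then have d: "CARD('c) - 1 \<le> dim (span (u ` ?T))"
    using card by (simp add: card_image [OF inj])
  have le: "card (u ` ?T) \<le> CARD('c) - 1"
    using card_image_le [of ?T u] T by simp
  show "independent (u ` ?T)"
    by (rule card_le_dim_spanning [OF span_superset order_refl _ order_trans [OF le d]]) simp
  have "dim (span (u ` ?T)) \<le> card (u ` ?T)"
    by (rule dim_le_card) auto
  then have "card (u ` ?T) = card ?T" using le d T by simp
  then show "inj_on u ?T" by (intro eq_card_imp_inj_on) auto
qed

section \<open>Gradients and Hessians of the loss\<close>

lemma GDERIV_unique:
  assumes "GDERIV F w :> D" "GDERIV F w :> D'"
  shows "D = D'"
proof -
  have "(\<lambda>h. h \<bullet> D) = (\<lambda>h. h \<bullet> D')"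
    using assms unfolding gderiv_def by (rule has_derivative_unique)
  then show ?thesis by (metis vector_eq_ldot)
qed

lemma gradient_eq: "GDERIV F w :> D \<Longrightarrow> gradient F w = D"
  unfolding gradient_def by (blast intro: GDERIV_unique)

lemma hessian_eq:
  assumes "(gradient F has_derivative (\<lambda>h. M *v h)) (at w)"
  shows "hessian F w = M"
  unfolding hessian_def jacobian_def
  by (simp flip: frechet_derivative_at [OF assms])

lemma hessian_works:
  assumes "gradient F differentiable (at w)"
  shows "(gradient F has_derivative (\<lambda>h. hessian F w *v h)) (at w)"
  using assms unfolding hessian_def by (simp add: jacobian_works)

lemma transpose_hessian:
  fixes F :: "real^'p \<Rightarrow> real"
  assumes F: "\<And>w. GDERIV F w :> gradient F w" and D: "gradient F differentiable (at w)"
  shows "transpose (hessian F w) = hessian F w"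
proof -
  let ?H = "hessian F w"
  have "(?H *v h) \<bullet> k = h \<bullet> (?H *v k)" for h k
    using symmetric_second_derivative [OF F hessian_works [OF D], of h k] by (simp add: inner_commute)
  then have "adjoint (\<lambda>z. ?H *v z) = (\<lambda>z. ?H *v z)"
    by (intro adjoint_unique) (simp add: inner_commute)
  then have "(\<lambda>z. transpose ?H *v z) = (\<lambda>z. ?H *v z)"
    by (simp add: adjoint_matrix)
  then show ?thesis by (metis matrix_of_matrix_vector_mul)
qed

text \<open>The log-sum-exp form leaves no quotient to differentiate.\<close>

lemma cross_entropy_eq: "cross_entropy z c = ln (\<Sum>k\<in>UNIV. exp (z $ k)) - z $ c"
proof -
  have "(\<Sum>k\<in>UNIV. exp (z $ k)) > 0" by (intro sum_pos) auto
  then show ?thesis by (simp add: cross_entropy_def softmax_def ln_div)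
qed

text \<open>Provides one gradient per logit. Its entries are components of \<open>F' w\<close>
  evaluated at the fixed vectors \<open>axis j 1\<close>; evaluation is bounded linear in
  \<open>F' w\<close>, so differentiability of \<open>F'\<close> carries over.\<close>

lemma twice_differentiable_component_gradient:
  fixes F :: "real^'p \<Rightarrow> real^'c"
  assumes "twice_differentiable F"
  obtains D where "\<And>k w. GDERIV (\<lambda>w. F w $ k) w :> D k w" "\<And>k w. D k differentiable (at w)"
proof -
  obtain F' where F': "\<And>w. (F has_derivative blinfun_apply (F' w)) (at w)"
    and F'd: "\<And>w. F' differentiable (at w)"
    using assms unfolding twice_differentiable_def by blast
  define D where "D k w = (\<chi> j. F' w (axis j 1) $ k)" for k w
  have "GDERIV (\<lambda>w. F w $ k) w :> D k w" for k w
  proof -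
    have h: "F' w h $ k = h \<bullet> D k w" for h
    proof -
      have "h = (\<Sum>j\<in>UNIV. (h $ j) *\<^sub>R axis j 1)"
        by (simp add: vec_eq_iff axis_def if_distrib cong: if_cong)
      then have "F' w h = (\<Sum>j\<in>UNIV. (h $ j) *\<^sub>R F' w (axis j 1))"
        by (metis (no_types, lifting) blinfun.scaleR_right blinfun.sum_right sum.cong)
      then show ?thesis by (simp add: D_def inner_vec_def)
    qed
    have "((\<lambda>w. F w $ k) has_derivative (\<lambda>h. F' w h $ k)) (at w)"
      by (rule bounded_linear.has_derivative [OF bounded_linear_vec_nth F'])
    then show ?thesis by (simp add: gderiv_def h)
  qed
  moreover have "D k differentiable (at w)" for k w
  proof -
    obtain F'' where F'': "(F' has_derivative F'') (at w)"
      using F'd unfolding differentiable_def by blast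
    have "((\<lambda>w. F' w (axis j 1) $ k) has_derivative (\<lambda>h. F'' h (axis j 1) $ k)) (at w)" for j
      by (rule bounded_linear.has_derivative [OF bounded_linear_vec_nth])
        (rule bounded_linear.has_derivative [OF blinfun.bounded_linear_left F''])
    then have "((\<lambda>w. \<chi> j. F' w (axis j 1) $ k) has_derivative (\<lambda>h. \<chi> j. F'' h (axis j 1) $ k)) (at w)"
      by (subst has_derivative_componentwise_within) (auto simp: Basis_vec_def inner_axis)
    then show ?thesis unfolding D_def [abs_def] by (rule differentiableI)
  qed
  ultimately show thesis by (rule that)
qed

lemma sample_loss_differentiable:
  fixes f :: "real^'p \<Rightarrow> real^'d \<Rightarrow> real^'c"
  assumes "\<And>u. twice_differentiable (\<lambda>w. f w u)"
  shows "GDERIV (sample_loss f x y i) w :> gradient (sample_loss f x y i) w"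
    and "gradient (sample_loss f x y i) differentiable (at w)"
proof -
  obtain D where D: "\<And>k w. GDERIV (\<lambda>w. f w (x i) $ k) w :> D k w"
    and Dd: "\<And>k w. D k differentiable (at w)"
    using twice_differentiable_component_gradient [OF assms] by metis
  let ?Z = "\<lambda>w. \<Sum>k\<in>UNIV. exp (f w (x i) $ k)"
  \<comment> \<open>The mean of the logit gradients with softmax weights, minus the gradient of the
    logit of the true class. Having this closed form shows that \<open>gradient\<close> is well
    defined here and differentiable in turn.\<close>
  define G where "G w = inverse (?Z w) *\<^sub>R (\<Sum>k\<in>UNIV. exp (f w (x i) $ k) *\<^sub>R D k w) - D (y i) w" for w
  have loss: "sample_loss f x y i = (\<lambda>w. ln (?Z w) - f w (x i) $ y i)"
    by (simp add: fun_eq_iff sample_loss_def cross_entropy_eq)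
  have Zpos: "?Z w > 0" for w by (intro sum_pos) auto
  note fd = D [unfolded gderiv_def]
  have Z': "(?Z has_derivative (\<lambda>h. h \<bullet> (\<Sum>k\<in>UNIV. exp (f w (x i) $ k) *\<^sub>R D k w))) (at w)" for w
    by (rule has_derivative_eq_rhs, rule has_derivative_sum, rule has_derivative_exp, rule fd)
      (simp add: inner_sum_right fun_eq_iff mult.commute)
  have G: "GDERIV (sample_loss f x y i) w :> G w" for w
    unfolding gderiv_def loss
    by (rule has_derivative_eq_rhs, rule has_derivative_diff, rule has_derivative_ln [OF Zpos Z'], rule fd)
      (simp add: G_def fun_eq_iff inner_diff_right divide_inverse)
  then have grad: "gradient (sample_loss f x y i) = G"
    using gradient_eq by blast
  show "GDERIV (sample_loss f x y i) w :> gradient (sample_loss f x y i) w"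
    using G by (simp add: grad)
  have "(\<lambda>w. exp (f w (x i) $ k)) differentiable (at w)" for k
    by (rule differentiableI, rule has_derivative_exp, rule fd)
  then have "(\<lambda>w. \<Sum>k\<in>UNIV. exp (f w (x i) $ k) *\<^sub>R D k w) differentiable (at w)"
    by (intro differentiable_sum ballI differentiable_scaleR Dd) auto
  moreover have "(\<lambda>w. inverse (?Z w)) differentiable (at w)"
    by (rule differentiable_inverse [OF differentiableI [OF Z']]) (use Zpos [of w] in simp)
  ultimately show "gradient (sample_loss f x y i) differentiable (at w)"
    unfolding grad G_def [abs_def] by (intro differentiable_diff differentiable_scaleR Dd)
qed

section \<open>Splitting averages by class; derivatives of the training loss\<close>

lemma sum_class_samples:
  fixes g :: "'n::finite \<Rightarrow> 'a::comm_monoid_add" and y :: "'n \<Rightarrow> 'c::finite"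
  shows "(\<Sum>i\<in>UNIV. g i) = (\<Sum>c\<in>UNIV. \<Sum>i\<in>class_samples y c. g i)"
  unfolding class_samples_def using sum.group [of UNIV UNIV y g] by simp

lemma average_by_class:
  fixes g :: "'n::finite \<Rightarrow> 'a::real_vector" and y :: "'n \<Rightarrow> 'c::finite"
  assumes "\<And>c. card (class_samples y c) \<noteq> 0"
  shows "(1 / real CARD('n)) *\<^sub>R (\<Sum>i\<in>UNIV. g i) =
    (\<Sum>c\<in>UNIV. (real (card (class_samples y c)) / real CARD('n)) *\<^sub>R
      ((1 / real (card (class_samples y c))) *\<^sub>R (\<Sum>i\<in>class_samples y c. g i)))"
  using assms by (simp add: sum_class_samples [of g y] scaleR_sum_right)

lemma train_loss_derivatives:
  fixes f :: "real^'p \<Rightarrow> real^'d \<Rightarrow> real^('c::finite)" and x :: "'n::finite \<Rightarrow> real^'d"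
  assumes smooth: "\<And>u. twice_differentiable (\<lambda>w. f w u)"
  shows "gradient (train_loss f x y) w = (1 / real CARD('n)) *\<^sub>R (\<Sum>i\<in>UNIV. gradient (sample_loss f x y i) w)"
    and "hessian (train_loss f x y) w = (1 / real CARD('n)) *\<^sub>R (\<Sum>i\<in>UNIV. hessian (sample_loss f x y i) w)"
proof -
  note sl = sample_loss_differentiable [OF smooth]
  have "GDERIV (train_loss f x y) w :> (1 / real CARD('n)) *\<^sub>R (\<Sum>i\<in>UNIV. gradient (sample_loss f x y i) w)" for w
    unfolding gderiv_def train_loss_def
    by (rule has_derivative_eq_rhs, rule has_derivative_mult_right, rule has_derivative_sum,
        rule sl [unfolded gderiv_def]) (simp add: fun_eq_iff inner_sum_right)
  \<comment> \<open>\<open>w\<close> is general here, since the formula is differentiated once more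
    as a function of the parameter.\<close>
  then show g: "gradient (train_loss f x y) w
      = (1 / real CARD('n)) *\<^sub>R (\<Sum>i\<in>UNIV. gradient (sample_loss f x y i) w)" for w
    by (rule gradient_eq)
  have "(gradient (train_loss f x y) has_derivative
      (\<lambda>h. (1 / real CARD('n)) *\<^sub>R (\<Sum>i\<in>UNIV. hessian (sample_loss f x y i) w *v h))) (at w)"
    unfolding g [abs_def] by (intro has_derivative_scaleR_right has_derivative_sum hessian_works sl)
  moreover have "(1 / real CARD('n)) *\<^sub>R (\<Sum>i\<in>UNIV. hessian (sample_loss f x y i) w *v h)
      = ((1 / real CARD('n)) *\<^sub>R (\<Sum>i\<in>UNIV. hessian (sample_loss f x y i) w)) *v h" for h
    by (simp add: sum_matrix_vector_mult flip: scaleR_matrix_vector_assoc)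
  ultimately show "hessian (train_loss f x y) w
      = (1 / real CARD('n)) *\<^sub>R (\<Sum>i\<in>UNIV. hessian (sample_loss f x y i) w)"
    by (intro hessian_eq) simp
qed

section \<open>The curvature bounds at time \<open>t\<close>\<close>

theorem theorem2:
  fixes f :: "real^'p \<Rightarrow> real^'d \<Rightarrow> real^('c::{finite,linorder})"
    and x :: "'n::finite \<Rightarrow> real^'d"
    and y :: "'n \<Rightarrow> 'c"
    and \<theta> :: "real \<Rightarrow> real^'p"
    and t \<nu> \<epsilon> :: real
    and H P :: "real^'p^'p"
    and Hc :: "'c \<Rightarrow> real^'p^'p"
  assumes smooth: "\<And>u. twice_differentiable (\<lambda>w. f w u)"
    and nonempty_classes: "\<And>c. card (class_samples y c) \<noteq> 0"
    and gradient_flow: "\<And>s. s \<ge> 0 \<Longrightarrow>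
      (\<theta> has_vector_derivative - gradient (train_loss f x y) (\<theta> s)) (at s within {0..})"
    and indep: "\<And>s. s \<ge> 0 \<Longrightarrow> \<exists>S. card S \<ge> CARD('c) - 1 \<and>
      inj_on (\<lambda>c. centered_gradient f x y c (\<theta> s)) S \<and>
      independent ((\<lambda>c. centered_gradient f x y c (\<theta> s)) ` S)"
    and t: "t \<ge> 0"
    and H_def: "H = hessian (train_loss f x y) (\<theta> t)"
    and Hc_def: "\<And>c. Hc c = class_hessian f x y c (\<theta> t)"
    and P_def: "P = grad_projection f x y (\<theta> t)"
    and class_lower: "\<And>c. lambda_min (Hc c) \<ge> - \<nu>"
    and eps: "\<epsilon> \<ge> op_norm ((mat 1 - P) ** H ** (mat 1 - P))"
  shows "lambda_min H \<ge> - \<nu> \<and>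
    (\<nu> \<ge> 0 \<longrightarrow>
      op_norm ((mat 1 - P) ** H) \<le> 2 * sqrt ((\<epsilon> + \<nu>) * (op_norm H + \<nu>)) \<and>
      (\<forall>c. op_norm ((mat 1 - P) ** Hc c)
        \<le> 2 * real CARD('n) / real (card (class_samples y c))
           * sqrt ((\<epsilon> + \<nu>) * (op_norm H + \<nu>))))"
proof (intro conjI impI allI)
  define r where "r c = real (card (class_samples y c)) / real CARD('n)" for c
  have r: "r c > 0" for c
    using nonempty_classes [of c] unfolding r_def by (intro divide_pos_pos) (auto simp: card_gt_0_iff)
  have "(\<Sum>c\<in>UNIV. real (card (class_samples y c))) = real CARD('n)"
    using sum_class_samples [of "\<lambda>_. 1 :: real" y] by simp
  then have r_sum: "(\<Sum>c\<in>UNIV. r c) = 1"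
    by (simp add: r_def flip: sum_divide_distrib)

  have "(\<Sum>c\<in>UNIV. r c *\<^sub>R class_gradient f x y c (\<theta> t)) = gradient (train_loss f x y) (\<theta> t)"
    unfolding train_loss_derivatives(1) [OF smooth] average_by_class [of y, OF nonempty_classes]
    by (simp add: r_def class_gradient_def)
  \<comment> \<open>The weights sum to 1 and the full gradient is the weighted mean of the class
    gradients. This is the linear relation that allows one row of G to be omitted.\<close>
  then have rel: "(\<Sum>c\<in>UNIV. r c *\<^sub>R centered_gradient f x y c (\<theta> t)) = 0"
    by (simp add: centered_gradient_def scaleR_diff_right sum_subtractf r_sum flip: scaleR_sum_left)
  have H_sum: "H = (\<Sum>c\<in>UNIV. r c *\<^sub>R Hc c)"
    unfolding H_def train_loss_derivatives(2) [OF smooth] average_by_class [of y, OF nonempty_classes]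
    by (simp add: r_def Hc_def class_hessian_def)

  have sym: "transpose (hessian (sample_loss f x y i) w) = hessian (sample_loss f x y i) w" for i w
    by (intro transpose_hessian sample_loss_differentiable smooth)
  have Hc_sym: "transpose (Hc c) = Hc c" for c
    unfolding Hc_def class_hessian_def by (intro transpose_scaleR_sum sym)
  have H_sym: "transpose H = H"
    unfolding H_def train_loss_derivatives(2) [OF smooth] by (intro transpose_scaleR_sum sym)

  have lower: "0 \<le> v \<bullet> (Hc c *v v) + \<nu> * (v \<bullet> v)" for c v
  proof -
    have "- \<nu> * (v \<bullet> v) \<le> lambda_min (Hc c) * (v \<bullet> v)"
      by (intro mult_right_mono class_lower) simp
    with lambda_min_le_quadratic_form [OF Hc_sym, of c v] show ?thesis by simp
  qed
  have form: "v \<bullet> (H *v v) + \<nu> * (v \<bullet> v) = (\<Sum>c\<in>UNIV. r c * (v \<bullet> (Hc c *v v) + \<nu> * (v \<bullet> v)))" for v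
  proof -
    have "v \<bullet> (H *v v) = (\<Sum>c\<in>UNIV. r c * (v \<bullet> (Hc c *v v)))"
      by (simp add: H_sum sum_matrix_vector_mult inner_sum_right flip: scaleR_matrix_vector_assoc)
    moreover have "\<nu> * (v \<bullet> v) = (\<Sum>c\<in>UNIV. r c * (\<nu> * (v \<bullet> v)))"
      by (simp add: r_sum flip: sum_distrib_right)
    ultimately show ?thesis by (simp add: distrib_left sum.distrib)
  qed
  have H_lower: "0 \<le> v \<bullet> (H *v v) + \<nu> * (v \<bullet> v)" for v
    unfolding form by (intro sum_nonneg mult_nonneg_nonneg less_imp_le [OF r] lower)
  \<comment> \<open>All terms of the weighted mean \<open>form\<close> are nonnegative, so a single
    one is at most the whole sum. This yields \<open>\<kappa> = 1 / r c\<close>.\<close>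
  have upper: "v \<bullet> (Hc c *v v) + \<nu> * (v \<bullet> v) \<le> 1 / r c * (v \<bullet> (H *v v) + \<nu> * (v \<bullet> v))" for c v
  proof -
    have "r c * (v \<bullet> (Hc c *v v) + \<nu> * (v \<bullet> v)) \<le> v \<bullet> (H *v v) + \<nu> * (v \<bullet> v)"
      unfolding form
      by (rule member_le_sum) (simp_all only: mult_nonneg_nonneg [OF less_imp_le [OF r] lower] UNIV_I finite)
    then show ?thesis using r [of c] by (simp add: field_simps)
  qed

  show "- \<nu> \<le> lambda_min H"
  proof (rule le_lambda_min [OF H_sym])
    show "- \<nu> * (v \<bullet> v) \<le> v \<bullet> (H *v v)" for v
      using H_lower [of v] by simp
  qed

  obtain S where S: "card S \<ge> CARD('c) - 1" "inj_on (\<lambda>c. centered_gradient f x y c (\<theta> t)) S"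
      "independent ((\<lambda>c. centered_gradient f x y c (\<theta> t)) ` S)"
    using indep [OF t] by blast
  have "{c. c < Max UNIV} = UNIV - {Max UNIV :: 'c}"
    by (auto simp: less_le)
  then have P: "P = row_projection (UNIV - {Max UNIV}) (\<lambda>c. centered_gradient f x y c (\<theta> t))"
    by (simp add: P_def grad_projection_def)
  \<comment> \<open>The relation has a nonzero coefficient at the last class. So whichever classes
    \<open>S\<close> provides, the rows of G, those of all other classes, are independent.\<close>
  have "r (Max UNIV) \<noteq> 0" using r by (metis less_irrefl)
  note ind = independent_remove_one [OF rel this S]
  note Q = row_projection_complement [OF finite ind, folded P]

  \<comment> \<open>The sign enters only from here on. With \<open>P = mat 1\<close>,
    \<open>\<epsilon> = 0\<close> and \<open>op_norm H + \<nu> > 0\<close>, a negative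
    \<open>\<nu>\<close> would put a negative number under the root.\<close>
  assume \<nu>: "\<nu> \<ge> 0"
  show "op_norm ((mat 1 - P) ** H) \<le> 2 * sqrt ((\<epsilon> + \<nu>) * (op_norm H + \<nu>))"
    using op_norm_compression_le [OF H_sym Q H_lower _ _ \<nu> eps, of 1] by simp
  fix c
  have "r c \<le> (\<Sum>c\<in>UNIV. r c)" by (rule member_le_sum) (auto simp: r less_imp_le)
  then have "1 / r c \<ge> 1" using r [of c] r_sum by simp
  then have "op_norm ((mat 1 - P) ** Hc c) \<le> 2 * (1 / r c) * sqrt ((\<epsilon> + \<nu>) * (op_norm H + \<nu>))"
    by (rule op_norm_compression_le [OF Hc_sym Q lower upper _ \<nu> eps])
  then show "op_norm ((mat 1 - P) ** Hc c) \<le> 2 * real CARD('n) / real (card (class_samples y c))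
      * sqrt ((\<epsilon> + \<nu>) * (op_norm H + \<nu>))"
    by (simp add: r_def)
qed

end
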